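(* Let $K\subset\mathbb{R}$ be the Cantor ternary set and let $s=\frac{\ln 2}{\ln 3}$. Then $$\frac{1}{2}\leq \mathcal{H}^s(K)\leq 1 \quad\text{and}\quad \dim_{\mathcal{H}}(K)=s.$$
   Context: Cantor ternary set: $K_0=[0,1]$; for each $n\ge 0$, $K_n$ is a union of $2^n$ disjoint closed intervals, and $K_{n+1}$ is obtained from $K_n$ by removing from each of these intervals its open middle third (so $K_1=[0,\frac13]\cup[\frac23,1]$, etc.). The Cantor ternary set is $K=\bigcap_{n\in\mathbb{N}}K_n$. Hausdorff measure on $\mathbb{R}$ (usual distance): for $A\subset\mathbb{R}$, $t\ge 0$ and $\epsilon>0$, let $\mathcal{R}_\epsilon(A)$ be the set of countable (finite or infinite) coverings of $A$ by subsets $X\subset\mathbb{R}$ with $\mathrm{diam}(X)\le\epsilon$, and put $$\mathcal{H}^t_\epsilon(A)=\inf_{D\in\mathcal{R}_\epsilon(A)}\sum_{X\in D}(\mathrm{diam}(X))^t,\qquad \mathcal{H}^t(A)=\lim_{\epsilon\to0}\mathcal{H}^t_\epsilon(A)=\sup_{\epsilon>0}\mathcal{H}^t_\epsilon(A).$$ For $t=0$, $(\mathrm{diam}(X))^0$ is $1$ if $X\ne\varnothing$ and $0$ if $X=\varnothing$. Hausdorff dimension: $\dim_{\mathcal{H}}(A)=\sup\{t\ge0:\mathcal{H}^t(A)=+\infty\}=\inf\{t\ge0:\mathcal{H}^t(A)=0\}$ (with $\sup\varnothing=0$). *)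

theory Defs
  imports "HOL-Analysis.Analysis"
begin

text \<open>The Cantor ternary set. The pair \<open>(a, b)\<close> stands for the closed interval \<open>{a..b}\<close>.\<close>

fun cantor_intervals :: "nat \<Rightarrow> (real \<times> real) set" where
  "cantor_intervals 0 = {(0, 1)}"
| "cantor_intervals (Suc n) =
     (\<Union>(a, b)\<in>cantor_intervals n. {(a, a + (b - a) / 3), (b - (b - a) / 3, b)})"

definition cantor_level :: "nat \<Rightarrow> real set" where
  "cantor_level n = (\<Union>(a, b)\<in>cantor_intervals n. {a..b})"

definition cantor_set :: "real set" where
  "cantor_set = (\<Inter>n. cantor_level n)"

lemma cantor_level_0: "cantor_level 0 = {0..1}"
  by (simp add: cantor_level_def)

lemma cantor_intervals_length: "(a, b) \<in> cantor_intervals n \<Longrightarrow> b - a = (1/3) ^ n"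
proof (induction n arbitrary: a b)
  case 0
  then show ?case by simp
next
  case (Suc n)
  then obtain p q where pq: "(p, q) \<in> cantor_intervals n"
    "(a, b) = (p, p + (q - p) / 3) \<or> (a, b) = (q - (q - p) / 3, q)"
    by auto
  have "b - a = (q - p) / 3" using pq(2) by auto
  then show ?case using Suc.IH[OF pq(1)] by simp
qed

lemma cantor_intervals_less: "(a, b) \<in> cantor_intervals n \<Longrightarrow> a < b"
  using cantor_intervals_length[of a b n] by (smt (verit) zero_less_power divide_pos_pos)

lemma cantor_intervals_disjoint:
  "\<lbrakk>(a, b) \<in> cantor_intervals n; (c, d) \<in> cantor_intervals n; (a, b) \<noteq> (c, d)\<rbrakk>
    \<Longrightarrow> {a..b} \<inter> {c..d} = {}"
proof (induction n arbitrary: a b c d)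
  case 0
  then show ?case by simp
next
  case (Suc n)
  obtain p q where pq: "(p, q) \<in> cantor_intervals n"
    "(a, b) = (p, p + (q - p) / 3) \<or> (a, b) = (q - (q - p) / 3, q)"
    using Suc.prems(1) by auto
  obtain r s where rs: "(r, s) \<in> cantor_intervals n"
    "(c, d) = (r, r + (s - r) / 3) \<or> (c, d) = (s - (s - r) / 3, s)"
    using Suc.prems(2) by auto
  have lt: "p < q" "r < s"
    using cantor_intervals_less pq(1) rs(1) by auto
  have sub: "{a..b} \<subseteq> {p..q}" "{c..d} \<subseteq> {r..s}"
    using pq(2) rs(2) lt by (auto simp: field_simps)
  show ?case
  proof (cases "(p, q) = (r, s)")
    case True
    then show ?thesis
      using pq(2) rs(2) lt Suc.prems(3) by (auto simp: field_simps)
  next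
    case False
    then show ?thesis
      using Suc.IH[OF pq(1) rs(1)] sub by blast
  qed
qed

lemma finite_cantor_intervals: "finite (cantor_intervals n)"
  by (induction n) auto

lemma card_cantor_intervals: "card (cantor_intervals n) = 2 ^ n"
proof (induction n)
  case 0
  show ?case by simp
next
  case (Suc n)
  let ?f = "\<lambda>(a::real, b::real). {(a, a + (b - a) / 3), (b - (b - a) / 3, b)}"
  have "card (\<Union>(?f ` cantor_intervals n)) = (\<Sum>I\<in>cantor_intervals n. card (?f I))"
  proof (rule card_UN_disjoint[OF finite_cantor_intervals])
    show "\<forall>I\<in>cantor_intervals n. finite (?f I)" by auto
    show "\<forall>I\<in>cantor_intervals n. \<forall>J\<in>cantor_intervals n. I \<noteq> J \<longrightarrow> ?f I \<inter> ?f J = {}"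
    proof (intro ballI impI)
      fix I J assume IJ: "I \<in> cantor_intervals n" "J \<in> cantor_intervals n" "I \<noteq> J"
      obtain a b c d where [simp]: "I = (a, b)" "J = (c, d)"
        by (cases I, cases J) auto
      have "a < b" "c < d" "{a..b} \<inter> {c..d} = {}"
        using IJ cantor_intervals_less cantor_intervals_disjoint by auto
      moreover from this have "a \<noteq> c" "b \<noteq> d" "a \<noteq> d" "b \<noteq> c"
        by fastforce+
      moreover have "b - (b - a) / 3 \<noteq> c" "d - (d - c) / 3 \<noteq> a"
      proof -
        have "b - (b - a) / 3 \<in> {a..b}" "c \<in> {c..d}" "d - (d - c) / 3 \<in> {c..d}" "a \<in> {a..b}"
          using \<open>a < b\<close> \<open>c < d\<close> by (auto simp: field_simps)
        then show "b - (b - a) / 3 \<noteq> c" "d - (d - c) / 3 \<noteq> a"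
          using \<open>{a..b} \<inter> {c..d} = {}\<close> by blast+
      qed
      ultimately show "?f I \<inter> ?f J = {}" by auto
    qed
  qed
  also have "\<dots> = (\<Sum>I\<in>cantor_intervals n. 2)"
  proof (rule sum.cong[OF refl])
    fix I assume "I \<in> cantor_intervals n"
    then show "card (?f I) = 2"
      using cantor_intervals_less[of "fst I" "snd I" n] by (cases I) (auto simp: field_simps)
  qed
  finally show ?case using Suc by simp
qed

lemma cantor_level_Suc:
  "cantor_level (Suc n) = cantor_level n -
     (\<Union>(a, b)\<in>cantor_intervals n. {a + (b - a) / 3 <..< b - (b - a) / 3})"
proof (intro set_eqI iffI)
  fix x assume "x \<in> cantor_level (Suc n)"
  then obtain a b where ab: "(a, b) \<in> cantor_intervals n"
    "x \<in> {a..a + (b - a) / 3} \<or> x \<in> {b - (b - a) / 3..b}"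
    unfolding cantor_level_def by fastforce
  have "a < b" using ab(1) cantor_intervals_less by auto
  then have x: "x \<in> {a..b}" using ab(2) by (auto simp: field_simps)
  have "x \<notin> {c + (d - c) / 3 <..< d - (d - c) / 3}" if cd: "(c, d) \<in> cantor_intervals n" for c d
  proof (cases "(a, b) = (c, d)")
    case True
    then show ?thesis using ab(2) \<open>a < b\<close> by auto
  next
    case False
    then have "x \<notin> {c..d}" using cantor_intervals_disjoint[OF ab(1) cd] x by blast
    then show ?thesis using cantor_intervals_less[OF cd] by (auto simp: field_simps)
  qed
  then show "x \<in> cantor_level n -
     (\<Union>(a, b)\<in>cantor_intervals n. {a + (b - a) / 3 <..< b - (b - a) / 3})"
    using x ab(1) unfolding cantor_level_def by blast
next
  fix x assume *: "x \<in> cantor_level n -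
     (\<Union>(a, b)\<in>cantor_intervals n. {a + (b - a) / 3 <..< b - (b - a) / 3})"
  then obtain a b where ab: "(a, b) \<in> cantor_intervals n" "x \<in> {a..b}"
    unfolding cantor_level_def by blast
  with * have "x \<in> {a..a + (b - a) / 3} \<or> x \<in> {b - (b - a) / 3..b}"
    by fastforce
  then show "x \<in> cantor_level (Suc n)"
    using ab(1) unfolding cantor_level_def by fastforce
qed

text \<open>
  The library's \<^const>\<open>diameter\<close> is meaningful for bounded sets only, so boundedness is required
  explicitly of the members of a covering. The separate case \<open>t = 0\<close> is needed because
  \<open>0 powr 0 = 0\<close>, whereas a singleton has to contribute \<open>1\<close>.
\<close>

definition diam_power :: "real \<Rightarrow> 'a::metric_space set \<Rightarrow> ennreal" where
  "diam_power t X =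
     (if X = {} then 0 else if t = 0 then 1 else ennreal (diameter X powr t))"

definition eps_covers :: "real \<Rightarrow> 'a::metric_space set \<Rightarrow> 'a set set set" where
  "eps_covers \<epsilon> A =
     {D. countable D \<and> A \<subseteq> \<Union>D \<and> (\<forall>X\<in>D. bounded X \<and> diameter X \<le> \<epsilon>)}"

definition hausdorff_premeasure :: "real \<Rightarrow> real \<Rightarrow> 'a::metric_space set \<Rightarrow> ennreal" where
  "hausdorff_premeasure t \<epsilon> A = (INF D\<in>eps_covers \<epsilon> A. \<Sum>\<^sub>\<infinity>X\<in>D. diam_power t X)"

definition hausdorff_measure :: "real \<Rightarrow> 'a::metric_space set \<Rightarrow> ennreal" where
  "hausdorff_measure t A = (SUP \<epsilon>\<in>{0<..}. hausdorff_premeasure t \<epsilon> A)"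

text \<open>In \<^typ>\<open>ennreal\<close> the supremum of the empty set is \<open>0\<close>.\<close>

definition hausdorff_dim :: "'a::metric_space set \<Rightarrow> ennreal" where
  "hausdorff_dim A = (SUP t\<in>{t. t \<ge> 0 \<and> hausdorff_measure t A = \<infinity>}. ennreal t)"

text \<open>The equivalent descriptions of the measure as a limit and of the dimension as an infimum.\<close>

lemma hausdorff_premeasure_antimono:
  assumes "\<epsilon> \<le> \<delta>"
  shows "hausdorff_premeasure t \<delta> A \<le> hausdorff_premeasure t \<epsilon> A"
  unfolding hausdorff_premeasure_def eps_covers_def
  using assms by (intro INF_superset_mono) force+

lemma tendsto_hausdorff_premeasure:
  "((\<lambda>\<epsilon>. hausdorff_premeasure t \<epsilon> A) \<longlongrightarrow> hausdorff_measure t A) (at_right 0)"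
proof (rule order_tendstoI)
  fix a assume "a < hausdorff_measure t A"
  then obtain \<epsilon> where \<epsilon>: "\<epsilon> > 0" "a < hausdorff_premeasure t \<epsilon> A"
    unfolding hausdorff_measure_def less_SUP_iff by auto
  have "\<forall>\<^sub>F \<delta> in at_right 0. \<delta> < \<epsilon>"
    using \<epsilon>(1) eventually_at_right_field by blast
  then show "\<forall>\<^sub>F \<delta> in at_right 0. a < hausdorff_premeasure t \<delta> A"
    by eventually_elim (use \<epsilon>(2) hausdorff_premeasure_antimono order_less_le_trans less_imp_le in blast)
next
  fix a assume a: "hausdorff_measure t A < a"
  have "hausdorff_premeasure t \<delta> A < a" if "\<delta> > 0" for \<delta>
    by (rule le_less_trans[OF _ a]) (use that in \<open>auto simp: hausdorff_measure_def intro: SUP_upper\<close>)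
  then show "\<forall>\<^sub>F \<delta> in at_right 0. hausdorff_premeasure t \<delta> A < a"
    using eventually_at_right_less by (force elim: eventually_mono)
qed

lemma infsum_cmult_ennreal:
  fixes f :: "'b \<Rightarrow> ennreal"
  shows "(\<Sum>\<^sub>\<infinity>x\<in>A. c * f x) = c * (\<Sum>\<^sub>\<infinity>x\<in>A. f x)"
  by (simp add: nonneg_infsum_complete SUP_mult_left_ennreal sum_distrib_left)

lemma diam_power_le:
  assumes "0 \<le> t" "t < u" "bounded X" "diameter X \<le> \<epsilon>" "0 < \<epsilon>"
  shows "diam_power u X \<le> ennreal (\<epsilon> powr (u - t)) * diam_power t X"
proof -
  have d: "0 \<le> diameter X" using assms(3) by (rule diameter_ge_0)
  have "diameter X powr u = diameter X powr (u - t) * diameter X powr t"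
    by (simp flip: powr_add)
  also have "\<dots> \<le> \<epsilon> powr (u - t) * diameter X powr t"
    using assms d by (intro mult_right_mono powr_mono2) auto
  finally have 1: "diameter X powr u \<le> \<epsilon> powr (u - t) * diameter X powr t" .
  have 2: "diameter X powr u \<le> \<epsilon> powr u"
    using assms d by (intro powr_mono2) auto
  show ?thesis
    using 1 2 assms by (auto simp: diam_power_def ennreal_leI simp flip: ennreal_mult')
qed

lemma hausdorff_premeasure_le:
  assumes "0 \<le> t" "t < u" "0 < \<epsilon>"
  shows "hausdorff_premeasure u \<epsilon> A \<le> ennreal (\<epsilon> powr (u - t)) * hausdorff_premeasure t \<epsilon> A"
proof -
  let ?c = "ennreal (\<epsilon> powr (u - t))"
  have c: "?c \<noteq> 0" "?c \<noteq> top" using assms by auto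
  have "hausdorff_premeasure u \<epsilon> A \<le> ?c * (\<Sum>\<^sub>\<infinity>X\<in>D. diam_power t X)"
    if D: "D \<in> eps_covers \<epsilon> A" for D
  proof -
    have "hausdorff_premeasure u \<epsilon> A \<le> (\<Sum>\<^sub>\<infinity>X\<in>D. diam_power u X)"
      unfolding hausdorff_premeasure_def by (rule INF_lower[OF D])
    also have "\<dots> \<le> (\<Sum>\<^sub>\<infinity>X\<in>D. ?c * diam_power t X)"
      using D assms by (intro infsum_mono nonneg_summable_on_complete)
        (auto simp: eps_covers_def intro: diam_power_le)
    finally show ?thesis by (simp add: infsum_cmult_ennreal)
  qed
  then have "hausdorff_premeasure u \<epsilon> A / ?c \<le> hausdorff_premeasure t \<epsilon> A"
    unfolding hausdorff_premeasure_def[of t]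
    by (intro INF_greatest) (metis c(1) divide_le_posI_ennreal zero_less_iff_neq_zero)
  then have "?c * (hausdorff_premeasure u \<epsilon> A / ?c) \<le> ?c * hausdorff_premeasure t \<epsilon> A"
    by (rule mult_left_mono) simp
  then show ?thesis
    using c by (simp add: ennreal_times_divide mult_divide_eq_ennreal mult.commute[of ?c])
qed

lemma hausdorff_measure_eq_0:
  assumes "0 \<le> t" "t < u" "hausdorff_measure t A < \<infinity>"
  shows "hausdorff_measure u A = 0"
proof -
  let ?M = "hausdorff_measure t A"
  have *: "hausdorff_premeasure u \<epsilon> A \<le> ennreal (\<epsilon> powr (u - t)) * ?M" if "\<epsilon> > 0" for \<epsilon>
    by (rule order_trans[OF hausdorff_premeasure_le[OF assms(1,2) that]])
      (use that in \<open>auto simp: hausdorff_measure_def intro!: mult_left_mono SUP_upper\<close>)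
  have "((\<lambda>\<epsilon>::real. \<epsilon> powr (u - t)) \<longlongrightarrow> 0) (at_right 0)"
    using assms(2) by (auto intro!: tendsto_eq_intros simp: eventually_at_right_less
        intro: eventually_mono[OF eventually_at_right_less])
  then have "((\<lambda>\<epsilon>. ennreal (\<epsilon> powr (u - t)) * ?M) \<longlongrightarrow> ennreal 0 * ?M) (at_right 0)"
    using assms(3) by (intro tendsto_mult_ennreal tendsto_ennrealI tendsto_const) auto
  then have "hausdorff_measure u A \<le> ennreal 0 * ?M"
    using tendsto_hausdorff_premeasure
    by (rule tendsto_le[OF trivial_limit_at_right_real])
      (rule eventually_mono[OF eventually_at_right_less *])
  then show ?thesis by simp
qed

lemma hausdorff_dim_eq_Inf:
  "hausdorff_dim A = (INF t\<in>{t. t \<ge> 0 \<and> hausdorff_measure t A = 0}. ennreal t)"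
proof (rule antisym)
  show "hausdorff_dim A \<le> (INF t\<in>{t. t \<ge> 0 \<and> hausdorff_measure t A = 0}. ennreal t)"
    unfolding hausdorff_dim_def
  proof (intro SUP_least INF_greatest)
    fix t u assume tu: "t \<in> {t. t \<ge> 0 \<and> hausdorff_measure t A = \<infinity>}"
      "u \<in> {t. t \<ge> 0 \<and> hausdorff_measure t A = 0}"
    then have "\<not> u < t"
      using hausdorff_measure_eq_0[of u t A] by auto
    then show "ennreal t \<le> ennreal u" by (simp add: ennreal_leI)
  qed
  show "(INF t\<in>{t. t \<ge> 0 \<and> hausdorff_measure t A = 0}. ennreal t) \<le> hausdorff_dim A"
  proof (rule ccontr)
    assume "\<not> ?thesis"
    then obtain x where x: "hausdorff_dim A < x"
      "x < (INF t\<in>{t. t \<ge> 0 \<and> hausdorff_measure t A = 0}. ennreal t)"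
      unfolding not_le by (meson dense)
    then obtain y where y: "x < y"
      "y < (INF t\<in>{t. t \<ge> 0 \<and> hausdorff_measure t A = 0}. ennreal t)"
      by (meson dense)
    obtain t u where t: "x = ennreal t" "0 \<le> t" and u: "y = ennreal u" "0 \<le> u"
      using x y by (cases x; cases y) (auto simp: top_unique)
    have "t < u" using y(1) t u by (simp add: ennreal_less_iff)
    have "hausdorff_measure t A \<noteq> \<infinity>"
    proof
      assume "hausdorff_measure t A = \<infinity>"
      then have "ennreal t \<le> hausdorff_dim A"
        unfolding hausdorff_dim_def using t by (intro SUP_upper) auto
      then show False using x t by simp
    qed
    then have "hausdorff_measure u A = 0"
      using hausdorff_measure_eq_0 t \<open>t < u\<close> by (simp add: less_top)
    then have "(INF t\<in>{t. t \<ge> 0 \<and> hausdorff_measure t A = 0}. ennreal t) \<le> ennreal u"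
      using u by (intro INF_lower) auto
    then show False using y u by simp
  qed
qed

end

theory Submission
  imports Defs
begin

text \<open>
  Upper bound: the \<open>2 ^ n\<close> intervals of level \<open>n\<close> have length \<open>3 ^ (- n)\<close>, and \<open>s\<close> is the exponent
  for which \<open>3 powr s = 2\<close>. Hence the sum belonging to this covering is exactly \<open>1\<close> at every level,
  while its mesh tends to \<open>0\<close>.

  Lower bound: there is a map from \<open>{0..<1}\<close> into the Cantor set, namely a right inverse of the
  Cantor function, which reads a binary digit \<open>d\<close> as the ternary digit \<open>2 * d\<close>. Suppose that two
  numbers first differ in their binary digit \<open>j + 1\<close>. They are at most \<open>2 ^ (- j)\<close> apart, and
  their images lie in different children of one interval of level \<open>j\<close>, so that these are at least
  \<open>3 ^ (- (j + 1))\<close> apart. As \<open>3 powr s = 2\<close>, distances \<open>\<delta>\<close> in the image correspond to distances of at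
  most \<open>2 * \<delta> powr s\<close> in \<open>{0..<1}\<close>. A covering of the Cantor set thus pulls back to a covering of
  \<open>{0..<1}\<close>, whose members lie in intervals of length at most twice the \<open>s\<close>-th power of the original
  diameters. These lengths add up to at least \<open>1\<close> because Lebesgue measure is countably
  subadditive (\<open>hausdorff_measure_lower_bound\<close>).

  A set whose \<open>s\<close>-dimensional measure is neither \<open>0\<close> nor infinite has dimension \<open>s\<close>
  (\<open>hausdorff_dim_eqI\<close>), since the measure can take such a value for one exponent only.
\<close>

section \<open>Bounding Hausdorff measure and dimension\<close>

lemma hausdorff_dim_eqI:
  assumes "0 \<le> s" "0 < hausdorff_measure s A" "hausdorff_measure s A < \<infinity>"
  shows "hausdorff_dim A = ennreal s"
proof (rule antisym)
  have "t \<le> s" if "hausdorff_measure t A = \<infinity>" for t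
    using hausdorff_measure_eq_0[of s t A] assms that by (cases "s < t") auto
  then show "hausdorff_dim A \<le> ennreal s"
    unfolding hausdorff_dim_def by (auto intro!: SUP_least ennreal_leI)
  have "s \<le> t" if "0 \<le> t" "hausdorff_measure t A = 0" for t
    using hausdorff_measure_eq_0[of t s A] assms that by (cases "t < s") auto
  then show "ennreal s \<le> hausdorff_dim A"
    unfolding hausdorff_dim_eq_Inf by (auto intro!: INF_greatest ennreal_leI)
qed

text \<open>
  The series on the right is unordered, whereas countable subadditivity of a measure is about
  sequences; the enumeration of \<open>D\<close> is padded with empty sets.
\<close>

lemma emeasure_UN_le_infsum:
  assumes D: "countable D" and meas: "\<And>X. X \<in> D \<Longrightarrow> F X \<in> sets M"
  shows "emeasure M (\<Union>X\<in>D. F X) \<le> (\<Sum>\<^sub>\<infinity>X\<in>D. emeasure M (F X))"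
proof -
  define N where "N = to_nat_on D ` D"
  define G where "G i = (if i \<in> N then F (from_nat_into D i) else {})" for i
  have into: "from_nat_into D i \<in> D" if "i \<in> N" for i
    using that D unfolding N_def by auto
  have inj: "inj_on (from_nat_into D) N"
    using D unfolding N_def by (auto intro!: inj_onI)
  have "(\<Union>X\<in>D. F X) \<subseteq> (\<Union>i. G i)"
  proof
    fix y assume "y \<in> (\<Union>X\<in>D. F X)"
    then obtain X where X: "X \<in> D" "y \<in> F X" by blast
    then have "y \<in> G (to_nat_on D X)"
      using D unfolding G_def N_def by auto
    then show "y \<in> (\<Union>i. G i)" by blast
  qed
  moreover have G: "range G \<subseteq> sets M"
    using meas into unfolding G_def by auto
  ultimately have "emeasure M (\<Union>X\<in>D. F X) \<le> emeasure M (\<Union>i. G i)"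
    by (intro emeasure_mono) auto
  also have "\<dots> \<le> (\<Sum>i. emeasure M (G i))"
    by (rule emeasure_subadditive_countably[OF G])
  also have "\<dots> \<le> (\<Sum>\<^sub>\<infinity>X\<in>D. emeasure M (F X))"
    unfolding suminf_eq_SUP
  proof (rule SUP_least)
    fix n
    have "(\<Sum>i<n. emeasure M (G i)) = (\<Sum>i\<in>{..<n} \<inter> N. emeasure M (F (from_nat_into D i)))"
      by (intro sum.mono_neutral_cong_right) (auto simp: G_def)
    also have "\<dots> = (\<Sum>X\<in>from_nat_into D ` ({..<n} \<inter> N). emeasure M (F X))"
      by (subst sum.reindex) (auto intro: inj_on_subset[OF inj])
    also have "\<dots> \<le> (\<Sum>\<^sub>\<infinity>X\<in>D. emeasure M (F X))"
      unfolding nonneg_infsum_complete[OF zero_le]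
      by (rule SUP_upper) (use into in auto)
    finally show "(\<Sum>i<n. emeasure M (G i)) \<le> (\<Sum>\<^sub>\<infinity>X\<in>D. emeasure M (F X))" .
  qed
  finally show ?thesis .
qed

text \<open>
  The inverse of \<open>g\<close> is Hoelder continuous with exponent \<open>s\<close>: the preimage of a set \<open>X\<close> lies in an interval of length
  \<open>C * diameter X powr s\<close>, and the preimages of the members of a covering cover \<open>{0..<1}\<close>.
\<close>

lemma hausdorff_measure_lower_bound:
  fixes g :: "real \<Rightarrow> 'a::metric_space"
  assumes "0 < s" "0 \<le> C"
    and into: "\<And>y. y \<in> {0..<1} \<Longrightarrow> g y \<in> A"
    and holder: "\<And>y z. y \<in> {0..<1} \<Longrightarrow> z \<in> {0..<1} \<Longrightarrow> \<bar>y - z\<bar> \<le> C * dist (g y) (g z) powr s"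
  shows "1 \<le> ennreal C * hausdorff_measure s A"
proof -
  (* The mesh does not matter for this estimate, so the coarse value 1 is as good as any other. *)
  have cover: "1 \<le> ennreal C * (\<Sum>\<^sub>\<infinity>X\<in>D. diam_power s X)" if D: "D \<in> eps_covers 1 A" for D
  proof -
    define Y where "Y X = {y \<in> {0..<1}. g y \<in> X}" for X
    define J where
      "J X = (if Y X = {} then {} else {Inf (Y X)..Inf (Y X) + C * diameter X powr s})" for X
    have Y_sub_J: "Y X \<subseteq> J X" if "X \<in> D" for X
    proof
      fix y assume y: "y \<in> Y X"
      have bdd: "bdd_below (Y X)" by (rule bdd_belowI[of _ 0]) (auto simp: Y_def)
      have "y - C * diameter X powr s \<le> z" if z: "z \<in> Y X" for z
      proof -
        have "dist (g y) (g z) \<le> diameter X"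
          using y z D \<open>X \<in> D\<close> by (intro diameter_bounded_bound) (auto simp: Y_def eps_covers_def)
        then have "C * dist (g y) (g z) powr s \<le> C * diameter X powr s"
          using assms(1,2) by (intro mult_left_mono powr_mono2) auto
        with holder[of y z] y z show ?thesis by (auto simp: Y_def)
      qed
      then have "y - C * diameter X powr s \<le> Inf (Y X)"
        using y by (intro cInf_greatest) auto
      moreover have "Inf (Y X) \<le> y" by (rule cInf_lower[OF y bdd])
      ultimately show "y \<in> J X" using y unfolding J_def by auto
    qed
    have "{0..<1} \<subseteq> (\<Union>X\<in>D. J X)"
    proof
      fix y :: real assume y: "y \<in> {0..<1}"
      then have "g y \<in> \<Union>D" using into[OF y] D unfolding eps_covers_def by blast
      then obtain X where "X \<in> D" "g y \<in> X" by blast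
      then show "y \<in> (\<Union>X\<in>D. J X)" using Y_sub_J[of X] y by (auto simp: Y_def)
    qed
    moreover have "(\<Union>X\<in>D. J X) \<in> sets lborel"
      using D by (intro sets.countable_UN') (auto simp: J_def eps_covers_def)
    ultimately have "emeasure lborel {0..<1::real} \<le> emeasure lborel (\<Union>X\<in>D. J X)"
      by (rule emeasure_mono)
    also have "\<dots> \<le> (\<Sum>\<^sub>\<infinity>X\<in>D. emeasure lborel (J X))"
      using D by (intro emeasure_UN_le_infsum) (auto simp: J_def eps_covers_def)
    also have "\<dots> \<le> (\<Sum>\<^sub>\<infinity>X\<in>D. ennreal C * diam_power s X)"
    proof (intro infsum_mono nonneg_summable_on_complete)
      fix X assume "X \<in> D"
      show "emeasure lborel (J X) \<le> ennreal C * diam_power s X"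
        using assms(1,2) by (auto simp: J_def Y_def diam_power_def ennreal_mult)
    qed auto
    finally show ?thesis by (simp add: infsum_cmult_ennreal)
  qed
  have "1 \<le> ennreal C * hausdorff_premeasure s 1 A"
  proof -
    have C: "ennreal C \<noteq> 0"
    proof
      assume "ennreal C = 0"
      then have "C = 0" using assms(2) by auto
      then show False using holder[of 0 "1/2"] by simp
    qed
    have "1 / ennreal C \<le> hausdorff_premeasure s 1 A"
      unfolding hausdorff_premeasure_def
      by (intro INF_greatest divide_le_posI_ennreal cover) (use C in \<open>auto simp: zero_less_iff_neq_zero\<close>)
    then have "ennreal C * (1 / ennreal C) \<le> ennreal C * hausdorff_premeasure s 1 A"
      by (rule mult_left_mono) simp
    then show ?thesis
      using C by (simp add: ennreal_times_divide)
  qed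
  also have "\<dots> \<le> ennreal C * hausdorff_measure s A"
    unfolding hausdorff_measure_def by (intro mult_left_mono SUP_upper) auto
  finally show ?thesis .
qed

section \<open>The upper bound\<close>

lemma powr_log_3_2:
  fixes s :: real
  assumes "s = ln 2 / ln 3"
  shows "((1/3) ^ n) powr s = (1/2) ^ n"
proof -
  have "(1/3::real) powr s = 1/2"
    using assms by (simp add: powr_def ln_div exp_minus)
  then have "((1/3::real) powr s) powr real n = (1/2) ^ n"
    by (simp only: powr_realpow)
  then show ?thesis by (simp add: powr_powr mult.commute flip: powr_realpow)
qed

lemma hausdorff_measure_cantor_le:
  fixes s :: real
  assumes s: "s = ln 2 / ln 3"
  shows "hausdorff_measure s cantor_set \<le> 1"
  unfolding hausdorff_measure_def
proof (rule SUP_least)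
  fix \<epsilon> :: real assume "\<epsilon> \<in> {0<..}"
  then obtain n where n: "(1/3) ^ n < \<epsilon>"
    using real_arch_pow_inv[of \<epsilon> "1/3"] by auto
  define D where "D = (\<lambda>(a, b). {a..b}) ` cantor_intervals n"
  have diam: "X \<noteq> {} \<and> bounded X \<and> diameter X = (1/3) ^ n" if X: "X \<in> D" for X
  proof -
    obtain a b where ab: "(a, b) \<in> cantor_intervals n" "X = {a..b}"
      using X unfolding D_def by auto
    then show ?thesis
      using cantor_intervals_less[OF ab(1)] cantor_intervals_length[OF ab(1)]
      by (simp add: diameter_closed_interval)
  qed
  have fin: "finite D" unfolding D_def using finite_cantor_intervals by simp
  have "cantor_set \<subseteq> \<Union>D"
    unfolding cantor_set_def D_def cantor_level_def by blast
  with diam n fin have "D \<in> eps_covers \<epsilon> cantor_set"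
    by (auto simp: eps_covers_def countable_finite)
  then have "hausdorff_premeasure s \<epsilon> cantor_set \<le> (\<Sum>\<^sub>\<infinity>X\<in>D. diam_power s X)"
    unfolding hausdorff_premeasure_def by (rule INF_lower)
  also have "\<dots> = (\<Sum>X\<in>D. ennreal ((1/2) ^ n))"
    using fin diam s powr_log_3_2[OF s, of n] by (simp add: diam_power_def)
  also have "\<dots> = ennreal (real (card D) * (1/2) ^ n)"
    by (simp add: ennreal_mult ennreal_of_nat_eq_real_of_nat)
  also have "\<dots> \<le> ennreal (2 ^ n * (1/2) ^ n)"
  proof (intro ennreal_leI mult_right_mono)
    have "card D \<le> 2 ^ n"
      unfolding D_def using card_image_le[OF finite_cantor_intervals] card_cantor_intervals by metis
    then show "real (card D) \<le> 2 ^ n" by (metis of_nat_le_iff of_nat_numeral of_nat_power)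
  qed auto
  also have "2 ^ n * (1/2) ^ n = (1::real)" by (simp flip: power_mult_distrib)
  finally show "hausdorff_premeasure s \<epsilon> cantor_set \<le> 1" by simp
qed

section \<open>A right inverse of the Cantor function\<close>

text \<open>
  The left endpoint of the interval of level \<open>n\<close> that is selected by the first \<open>n\<close> binary digits
  of \<open>y\<close>, a digit \<open>1\<close> meaning the right child.
\<close>

fun cantor_left :: "nat \<Rightarrow> real \<Rightarrow> real" where
  "cantor_left 0 y = 0"
| "cantor_left (Suc n) y =
     cantor_left n y + 2 * of_int (\<lfloor>2 ^ Suc n * y\<rfloor> mod 2) * (1/3) ^ Suc n"

definition cantor_point :: "real \<Rightarrow> real" where
  "cantor_point y = (SUP n. cantor_left n y)"

lemma cantor_left_interval:
  "(cantor_left n y, cantor_left n y + (1/3) ^ n) \<in> cantor_intervals n"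
proof (induction n)
  case 0
  show ?case by simp
next
  case (Suc n)
  have "\<lfloor>2 ^ Suc n * y\<rfloor> mod 2 = 0 \<or> \<lfloor>2 ^ Suc n * y\<rfloor> mod 2 = 1" by presburger
  then show ?case
  proof
    assume "\<lfloor>2 ^ Suc n * y\<rfloor> mod 2 = 0"
    then have "cantor_left (Suc n) y = cantor_left n y" by simp
    then show ?thesis
      unfolding cantor_intervals.simps by (intro UN_I[OF Suc]) simp
  next
    assume "\<lfloor>2 ^ Suc n * y\<rfloor> mod 2 = 1"
    then have "cantor_left (Suc n) y = cantor_left n y + 2 * (1/3) ^ Suc n" by simp
    then show ?thesis
      unfolding cantor_intervals.simps by (intro UN_I[OF Suc]) simp
  qed
qed

lemma cantor_left_nested:
  assumes "n \<le> m"
  shows "cantor_left n y \<le> cantor_left m y \<and> cantor_left m y + (1/3) ^ m \<le> cantor_left n y + (1/3) ^ n"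
  using assms
proof (induction m rule: dec_induct)
  case base
  show ?case by simp
next
  case (step m)
  define d where "d = \<lfloor>2 ^ Suc m * y\<rfloor> mod 2"
  have "0 \<le> d" "d \<le> 1" unfolding d_def by presburger+
  then have "0 \<le> real_of_int d * (1/3) ^ Suc m"
    "real_of_int d * (1/3) ^ Suc m \<le> 1 * (1/3) ^ Suc m"
    by (auto intro!: mult_right_mono simp del: power_Suc)
  moreover have "cantor_left (Suc m) y = cantor_left m y + 2 * (real_of_int d * (1/3) ^ Suc m)"
    unfolding d_def by (simp only: cantor_left.simps mult.assoc)
  moreover have "(1/3::real) ^ m = 3 * (1/3) ^ Suc m" by simp
  ultimately show ?case using step.IH by linarith
qed

lemma cantor_point_bounds:
  "cantor_left n y \<le> cantor_point y" "cantor_point y \<le> cantor_left n y + (1/3) ^ n"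
proof -
  have le: "cantor_left m y \<le> cantor_left n y + (1/3) ^ n" for m n
  proof -
    have "cantor_left m y \<le> cantor_left (max m n) y"
      using cantor_left_nested[of m "max m n" y] by simp
    also have "\<dots> \<le> cantor_left (max m n) y + (1/3) ^ max m n" by simp
    also have "\<dots> \<le> cantor_left n y + (1/3) ^ n"
      using cantor_left_nested[of n "max m n" y] by simp
    finally show ?thesis .
  qed
  then have "bdd_above (range (\<lambda>n. cantor_left n y))"
    by (intro bdd_aboveI2[where M = "cantor_left 0 y + (1/3) ^ 0"])
  then show "cantor_left n y \<le> cantor_point y"
    unfolding cantor_point_def by (intro cSUP_upper) auto
  show "cantor_point y \<le> cantor_left n y + (1/3) ^ n"
    unfolding cantor_point_def by (intro cSUP_least le) auto
qed

lemma cantor_point_in_cantor_set: "cantor_point y \<in> cantor_set"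
  unfolding cantor_set_def cantor_level_def
  using cantor_left_interval cantor_point_bounds by fastforce

text \<open>
  The least level \<open>k\<close> at which the dyadic intervals of \<open>y\<close> and \<open>z\<close> differ decides: one level earlier
  they share an interval, which bounds their distance from above, and at level \<open>k\<close> the images are
  separated by a removed middle third.
\<close>

lemma cantor_point_Hoelder:
  assumes s: "s = ln 2 / ln 3" and y: "y \<in> {0..<1}" and z: "z \<in> {0..<1}"
  shows "\<bar>y - z\<bar> \<le> 2 * dist (cantor_point y) (cantor_point z) powr s"
proof (cases "y = z")
  case True
  then show ?thesis by simp
next
  case False
  have "\<exists>k. \<lfloor>2 ^ k * y\<rfloor> \<noteq> \<lfloor>2 ^ k * z\<rfloor>"
  proof -
    obtain k where k: "(1/2) ^ k < \<bar>y - z\<bar>"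
      using real_arch_pow_inv[of "\<bar>y - z\<bar>" "1/2"] False by auto
    then have "1 < 2 ^ k * \<bar>y - z\<bar>"
      by (simp add: power_one_over field_simps)
    also have "\<dots> = \<bar>2 ^ k * y - 2 ^ k * z\<bar>"
      by (simp add: abs_mult flip: right_diff_distrib)
    finally show ?thesis by (intro exI[of _ k]) linarith
  qed
  then obtain k where k: "\<lfloor>2 ^ k * y\<rfloor> \<noteq> \<lfloor>2 ^ k * z\<rfloor>"
    and least: "\<And>i. i < k \<Longrightarrow> \<lfloor>2 ^ i * y\<rfloor> = \<lfloor>2 ^ i * z\<rfloor>"
    using exists_least_iff[of "\<lambda>k. \<lfloor>2 ^ k * y\<rfloor> \<noteq> \<lfloor>2 ^ k * z\<rfloor>"] by blast
  have "\<lfloor>y\<rfloor> = 0" "\<lfloor>z\<rfloor> = 0" using y z by (auto simp: floor_eq_iff)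
  with k obtain j where j: "k = Suc j" by (cases k) auto
  have same: "cantor_left i y = cantor_left i z" if "i \<le> j" for i
    using that
  proof (induction i)
    case (Suc i)
    then have "\<lfloor>2 ^ Suc i * y\<rfloor> = \<lfloor>2 ^ Suc i * z\<rfloor>" by (intro least) (simp add: j)
    with Suc show ?case by simp
  qed simp
  have eq: "\<lfloor>2 ^ j * y\<rfloor> = \<lfloor>2 ^ j * z\<rfloor>" using least j by simp
  then have "\<bar>2 ^ j * y - 2 ^ j * z\<bar> \<le> 1" by linarith
  then have "2 ^ j * \<bar>y - z\<bar> \<le> 1"
    by (simp add: abs_mult flip: right_diff_distrib)
  then have near: "\<bar>y - z\<bar> \<le> (1/2) ^ j"
    by (simp add: field_simps)
  have digits: "\<lfloor>2 ^ Suc j * y\<rfloor> mod 2 \<noteq> \<lfloor>2 ^ Suc j * z\<rfloor> mod 2"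
  proof -
    have parent: "\<lfloor>2 ^ Suc j * x\<rfloor> div 2 = \<lfloor>2 ^ j * x\<rfloor>" for x :: real
      using floor_divide_real_eq_div[of 2 "2 ^ Suc j * x"] by simp
    show ?thesis
      using parent[of y] parent[of z] eq k unfolding j
      by (metis div_mult_mod_eq)
  qed
  have far: "(1/3) ^ Suc j \<le> \<bar>cantor_point y - cantor_point z\<bar>"
  proof -
    have "\<lfloor>2 ^ Suc j * y\<rfloor> mod 2 = 0 \<and> \<lfloor>2 ^ Suc j * z\<rfloor> mod 2 = 1 \<or>
          \<lfloor>2 ^ Suc j * y\<rfloor> mod 2 = 1 \<and> \<lfloor>2 ^ Suc j * z\<rfloor> mod 2 = 0"
      using digits by presburger
    then have "cantor_left (Suc j) z = cantor_left (Suc j) y + 2 * (1/3) ^ Suc j \<or>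
               cantor_left (Suc j) y = cantor_left (Suc j) z + 2 * (1/3) ^ Suc j"
      using same[of j] by auto
    then show ?thesis
      using cantor_point_bounds[where n = "Suc j" and y = y]
        cantor_point_bounds[where n = "Suc j" and y = z] by linarith
  qed
  have "0 < s" using s by simp
  have "\<bar>y - z\<bar> \<le> 2 * (1/2) ^ Suc j" using near by simp
  also have "\<dots> = 2 * ((1/3) ^ Suc j) powr s" by (simp only: powr_log_3_2[OF s])
  also have "\<dots> \<le> 2 * \<bar>cantor_point y - cantor_point z\<bar> powr s"
    using far \<open>0 < s\<close> by (intro mult_left_mono powr_mono2) auto
  finally show ?thesis by (simp add: dist_real_def)
qed

section \<open>Measure and dimension of the Cantor set\<close>

theorem theorem4:
  fixes s :: real
  assumes "s = ln 2 / ln 3"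
  shows "1 / 2 \<le> hausdorff_measure s cantor_set \<and> hausdorff_measure s cantor_set \<le> 1 \<and>
         hausdorff_dim cantor_set = ennreal s"
proof -
  let ?H = "hausdorff_measure s cantor_set"
  have s: "0 < s" using assms by simp
  have "1 \<le> ennreal 2 * ?H"
    using s cantor_point_in_cantor_set cantor_point_Hoelder[OF assms]
    by (intro hausdorff_measure_lower_bound[where g = cantor_point]) auto
  then have lower: "1 / 2 \<le> ?H"
    by (intro divide_le_posI_ennreal) auto
  have upper: "?H \<le> 1" by (rule hausdorff_measure_cantor_le[OF assms])
  have "0 < ?H" using \<open>1 \<le> ennreal 2 * ?H\<close> by (auto simp: zero_less_iff_neq_zero)
  moreover have "?H < \<infinity>" using upper by (simp add: order_le_less_trans)
  ultimately have "hausdorff_dim cantor_set = ennreal s"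
    using s by (intro hausdorff_dim_eqI) auto
  with lower upper show ?thesis by blast
qed

end
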